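(* For every prime $p$ and all integers $n \ge 1$ and $r \ge 1$, there exists a finite graph $G$ such that the magnitude homology group $\mathrm{MH}_{3,2n+3}(G)$ contains a subgroup isomorphic to $\mathbb{Z}_{p^r}$. In particular, for each prime $p$ and positive integer $r$ there is a graph whose magnitude homology contains $\mathbb{Z}_{p^r}$-torsion.
   Context: All graphs are finite, undirected, with no loops and no multiple edges. For a graph $G$, $d(x,y)$ denotes the shortest-path distance between vertices $x,y$ (each edge has length $1$; $d(x,y)=\infty$ if there is no path). A $k$-path is a $(k+1)$-tuple $(x_0,\dots,x_k)$ of vertices with $x_i\neq x_{i+1}$ and $d(x_i,x_{i+1})<\infty$ for $0\le i\le k-1$; its length is $\ell(x_0,\dots,x_k)=\sum_{i=0}^{k-1} d(x_i,x_{i+1})$. Let $\mathrm{MC}_{k,\ell}(G)$ be the free abelian group on all $k$-paths of length $\ell$. For $1\le i\le k-1$ let $\partial_i:\mathrm{MC}_{k,\ell}(G)\to \mathrm{MC}_{k-1,\ell}(G)$ send $(x_0,\dots,x_k)$ to $(x_0,\dots,x_{i-1},x_{i+1},\dots,x_k)$ if this tuple is a $(k-1)$-path of length $\ell$, and to $0$ otherwise; set $\partial=\sum_{i=1}^{k-1}(-1)^i\partial_i$. Then $(\mathrm{MC}_{*,\ell}(G),\partial)$ is a chain complex for each $\ell$, and the magnitude homology is $\mathrm{MH}_{k,\ell}(G)=H_k(\mathrm{MC}_{*,\ell}(G))$. *)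

theory Defs
  imports
    "HOL-Algebra.Free_Abelian_Groups"
    "HOL-Algebra.Elementary_Groups"
    "HOL-Algebra.Coset"
    "HOL-Computational_Algebra.Primes"
    "HOL-Library.Extended_Nat"
begin

text \<open>An undirected graph is given by its vertex set \<open>V\<close> and its (symmetric) adjacency
  relation \<open>E\<close>; irreflexivity rules out loops, and a relation cannot have multiple edges.\<close>

locale finite_simple_graph =
  fixes V :: "'a set" and E :: "'a rel"
  assumes finite_verts: "finite V"
    and adj_in_verts: "E \<subseteq> V \<times> V"
    and sym_adj: "sym E"
    and irrefl_adj: "irrefl E"

text \<open>\<open>(x, y) \<in> E ^^ n\<close> says that there is a walk of length \<open>n\<close> from \<open>x\<close> to \<open>y\<close>.
  The infimum over the empty set is \<open>\<infinity>\<close>.\<close>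

definition graph_dist :: "'a rel \<Rightarrow> 'a \<Rightarrow> 'a \<Rightarrow> enat"
  where "graph_dist E x y = (INF n \<in> {n. (x, y) \<in> E ^^ n}. enat n)"

text \<open>The tuple \<open>(x\<^sub>0, \<dots>, x\<^sub>k)\<close> is the list \<open>[x\<^sub>0, \<dots>, x\<^sub>k]\<close> of length \<open>k + 1\<close>.\<close>

definition is_k_path :: "'a set \<Rightarrow> 'a rel \<Rightarrow> nat \<Rightarrow> 'a list \<Rightarrow> bool"
  where "is_k_path V E k xs \<longleftrightarrow>
    length xs = k + 1 \<and> set xs \<subseteq> V \<and>
    (\<forall>i<k. xs ! i \<noteq> xs ! (i + 1) \<and> graph_dist E (xs ! i) (xs ! (i + 1)) < \<infinity>)"

definition path_length :: "'a rel \<Rightarrow> 'a list \<Rightarrow> enat"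
  where "path_length E xs = (\<Sum>i<length xs - 1. graph_dist E (xs ! i) (xs ! (i + 1)))"

definition k_paths :: "'a set \<Rightarrow> 'a rel \<Rightarrow> nat \<Rightarrow> nat \<Rightarrow> 'a list set"
  where "k_paths V E k l = {xs. is_k_path V E k xs \<and> path_length E xs = enat l}"

definition magnitude_chain_group :: "'a set \<Rightarrow> 'a rel \<Rightarrow> nat \<Rightarrow> nat \<Rightarrow> ('a list \<Rightarrow>\<^sub>0 int) monoid"
  where "magnitude_chain_group V E k l = free_Abelian_group (k_paths V E k l)"

definition delete_nth :: "nat \<Rightarrow> 'a list \<Rightarrow> 'a list"
  where "delete_nth i xs = take i xs @ drop (i + 1) xs"

definition magnitude_face ::
    "'a set \<Rightarrow> 'a rel \<Rightarrow> nat \<Rightarrow> nat \<Rightarrow> nat \<Rightarrow> ('a list \<Rightarrow>\<^sub>0 int) \<Rightarrow> ('a list \<Rightarrow>\<^sub>0 int)"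
  where "magnitude_face V E k l i =
    frag_extend (\<lambda>xs. if delete_nth i xs \<in> k_paths V E (k - 1) l
                       then frag_of (delete_nth i xs) else 0)"

text \<open>For \<open>k \<le> 1\<close> the sum is empty, so the boundary map is zero; in particular every
  chain in degree 0 is a cycle, and the truncated \<open>k - 1\<close> at \<open>k = 0\<close> is never used.\<close>

definition magnitude_boundary ::
    "'a set \<Rightarrow> 'a rel \<Rightarrow> nat \<Rightarrow> nat \<Rightarrow> ('a list \<Rightarrow>\<^sub>0 int) \<Rightarrow> ('a list \<Rightarrow>\<^sub>0 int)"
  where "magnitude_boundary V E k l c =
    (\<Sum>i\<in>{1..<k}. frag_cmul ((- 1) ^ i) (magnitude_face V E k l i c))"

definition magnitude_cycles :: "'a set \<Rightarrow> 'a rel \<Rightarrow> nat \<Rightarrow> nat \<Rightarrow> ('a list \<Rightarrow>\<^sub>0 int) set"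
  where "magnitude_cycles V E k l =
    {c \<in> carrier (magnitude_chain_group V E k l). magnitude_boundary V E k l c = 0}"

definition magnitude_boundaries :: "'a set \<Rightarrow> 'a rel \<Rightarrow> nat \<Rightarrow> nat \<Rightarrow> ('a list \<Rightarrow>\<^sub>0 int) set"
  where "magnitude_boundaries V E k l =
    magnitude_boundary V E (k + 1) l ` carrier (magnitude_chain_group V E (k + 1) l)"

definition magnitude_homology ::
    "'a set \<Rightarrow> 'a rel \<Rightarrow> nat \<Rightarrow> nat \<Rightarrow> ('a list \<Rightarrow>\<^sub>0 int) set monoid"
  where "magnitude_homology V E k l =
    subgroup_generated (magnitude_chain_group V E k l) (magnitude_cycles V E k l)
      Mod magnitude_boundaries V E k l"

definition has_subgroup_iso :: "'a monoid \<Rightarrow> 'b monoid \<Rightarrow> bool"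
  where "has_subgroup_iso G K \<longleftrightarrow> (\<exists>H. subgroup H G \<and> G\<lparr>carrier := H\<rparr> \<cong> K)"

end

theory Submission
  imports Defs "HOL-Library.Countable"
begin

text \<open>Between two vertices whose distance is exactly \<open>l\<close>, the chains of length \<open>l\<close> compute, with a
  shift by two, the homology of the order complex of the open interval of points lying on
  geodesics. So it suffices to realise the face poset of a Moore space
  (a disk glued to a circle by a map of degree \<open>N = p ^ r\<close>) as such an interval, whose height is
  then adjusted by subdividing the lowest edges. The circle gives a 3-cycle \<open>c\<close>,
  the disk a 4-chain with boundary \<open>N c\<close>, and a 1-cocycle modulo \<open>N\<close> with value 1 on \<open>c\<close>
  shows that no smaller multiple of \<open>c\<close> bounds.\<close>

section \<open>Cyclic subgroups of quotients\<close>

text \<open>The map sending \<open>j\<close> to the coset of \<open>x [^] j\<close> is a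
  homomorphism from the integers whose kernel is the set of multiples of \<open>n\<close>, so its
  image is cyclic of order \<open>n\<close>. It lands in the quotient of \<open>Z\<close> because
  \<open>x \<in> Z\<close>.\<close>

lemma (in comm_group) has_subgroup_iso_Mod_cyclic:
  assumes Z: "subgroup Z G" and B: "subgroup B G" and x: "x \<in> Z" and n: "n > 0"
    and ord: "\<And>j::int. x [^] j \<in> B \<longleftrightarrow> int n dvd j"
  shows "has_subgroup_iso (subgroup_generated G Z Mod B) (integer_mod_group n)"
proof -
  define K where "K = (\<lambda>z. B #> z) ` Z"
  define h where "h = (\<lambda>j::int. B #> x [^] j)"
  have xG: "x \<in> carrier G"
    using Z x subgroup.subset by blast
  interpret B: normal B G
    using B by (simp add: normal_iff_subgroup)
  interpret q: group_hom G "G Mod B" "\<lambda>a. B #> a"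
    using B.r_coset_hom_Mod B.factorgroup_is_group
    by (simp add: group_hom_def group_hom_axioms_def)
  have carr: "carrier (subgroup_generated G Z) = Z"
    by (simp add: Z subgroup.carrier_subgroup_generated_subgroup)
  \<comment> \<open>The quotient of \<open>Z\<close> is viewed inside \<open>G Mod B\<close>, where
    the coset map is a homomorphism on all of \<open>G\<close>.\<close>
  have MH: "subgroup_generated G Z Mod B = (G Mod B)\<lparr>carrier := K\<rparr>"
  proof -
    have "rcosets\<^bsub>subgroup_generated G Z\<^esub> B = K"
      by (auto simp: RCOSETS_def K_def carr r_coset_def)
    moreover have "set_mult (subgroup_generated G Z) = set_mult G"
      by (intro ext) (simp add: set_mult_def)
    ultimately show ?thesis
      by (simp add: FactGroup_def)
  qed
  have K: "subgroup K (G Mod B)"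
    unfolding K_def using q.subgroup_img_is_subgroup [OF Z] .
  have hom: "h (i + j) = h i \<otimes>\<^bsub>G Mod B\<^esub> h j" for i j
    unfolding h_def int_pow_mult [OF xG] using xG by (subst q.hom_mult) simp_all
  have h_eq: "h i = h j \<longleftrightarrow> int n dvd i - j" for i j
  proof -
    have "h i = h j \<longleftrightarrow> x [^] i \<in> B #> x [^] j"
      unfolding h_def using xG B rcos_self repr_independence by (metis int_pow_closed)
    also have "\<dots> \<longleftrightarrow> x [^] i \<otimes> inv (x [^] j) \<in> B"
      using xG by (simp add: subgroup.rcos_module [OF B is_group])
    also have "x [^] i \<otimes> inv (x [^] j) = x [^] (i - j)"
      using xG by (simp add: int_pow_diff)
    finally show ?thesis
      using ord by simp
  qed
  have H_eq: "range h = h ` {0..<int n}"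
  proof -
    have "h j \<in> h ` {0..<int n}" for j
    proof
      show "h j = h (j mod int n)"
        unfolding h_eq by (simp add: minus_mod_eq_mult_div)
    qed (use n in simp)
    then show ?thesis by blast
  qed
  interpret hh: group_hom integer_group "G Mod B" h
    using hom xG B.factorgroup_is_group
    by (auto simp: group_hom_def group_hom_axioms_def hom_def h_def)
  have H: "subgroup (range h) (G Mod B)"
    using hh.img_is_subgroup by simp
  have "range h \<subseteq> K"
    using x by (auto simp: h_def K_def intro!: subgroup_int_pow_closed [OF Z])
  then have sub: "subgroup (range h) ((G Mod B)\<lparr>carrier := K\<rparr>)"
    using group.subgroup_incl [OF B.factorgroup_is_group H K] by simp
  have "h \<in> iso (integer_mod_group n) ((G Mod B)\<lparr>carrier := range h\<rparr>)"
  proof (intro isoI)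
    show "h \<in> hom (integer_mod_group n) ((G Mod B)\<lparr>carrier := range h\<rparr>)"
    proof (rule homI)
      fix i j
      have "h ((i + j) mod int n) = h (i + j)"
        unfolding h_eq by (simp add: mod_eq_dvd_iff [symmetric])
      then show "h (i \<otimes>\<^bsub>integer_mod_group n\<^esub> j) = h i \<otimes>\<^bsub>(G Mod B)\<lparr>carrier := range h\<rparr>\<^esub> h j"
        by (simp add: hom)
    qed auto
    show "bij_betw h (carrier (integer_mod_group n)) (carrier ((G Mod B)\<lparr>carrier := range h\<rparr>))"
      unfolding bij_betw_def
    proof
      show "inj_on h (carrier (integer_mod_group n))"
        using n by (auto simp: inj_on_def h_eq carrier_integer_mod_group simp flip: mod_eq_dvd_iff)
      show "h ` carrier (integer_mod_group n) = carrier ((G Mod B)\<lparr>carrier := range h\<rparr>)"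
        using n H_eq by (simp add: carrier_integer_mod_group)
    qed
  qed
  then have "(G Mod B)\<lparr>carrier := range h\<rparr> \<cong> integer_mod_group n"
    by (metis group.iso_sym group_integer_mod_group is_isoI)
  then show ?thesis
    using sub unfolding has_subgroup_iso_def MH by auto
qed

section \<open>Torsion detected by a cocycle\<close>

lemma magnitude_face_diff:
  "magnitude_face V E k l i (c - d) = magnitude_face V E k l i c - magnitude_face V E k l i d"
  by (simp add: magnitude_face_def frag_extend_diff)

lemma magnitude_boundary_0 [simp]: "magnitude_boundary V E k l 0 = 0"
  by (simp add: magnitude_boundary_def magnitude_face_def)

lemma magnitude_boundary_diff:
  "magnitude_boundary V E k l (c - d) = magnitude_boundary V E k l c - magnitude_boundary V E k l d"
proof -
  have "frag_cmul z (x - y) = frag_cmul z x - frag_cmul z y" for z and x y :: "'a list \<Rightarrow>\<^sub>0 int"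
    by (metis add_diff_cancel diff_add_cancel frag_cmul_distrib2)
  then show ?thesis
    by (simp add: magnitude_boundary_def magnitude_face_diff sum_subtractf)
qed

lemma magnitude_boundary_uminus:
  "magnitude_boundary V E k l (- c) = - magnitude_boundary V E k l c"
  using magnitude_boundary_diff [of V E k l 0 c] by simp

lemma magnitude_boundary_add:
  "magnitude_boundary V E k l (c + d) = magnitude_boundary V E k l c + magnitude_boundary V E k l d"
  using magnitude_boundary_diff [of V E k l c "- d"] by (simp add: magnitude_boundary_uminus)

lemma magnitude_boundary_sum:
  "magnitude_boundary V E k l (sum f I) = (\<Sum>i\<in>I. magnitude_boundary V E k l (f i))"
  by (induction I rule: infinite_finite_induct) (simp_all add: magnitude_boundary_add)

lemma keys_magnitude_boundary:
  "Poly_Mapping.keys (magnitude_boundary V E k l c) \<subseteq> k_paths V E (k - 1) l"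
proof -
  have "Poly_Mapping.keys (magnitude_face V E k l i c) \<subseteq> k_paths V E (k - 1) l" for i
    unfolding magnitude_face_def using keys_frag_extend by (fastforce split: if_splits)
  then show ?thesis
    unfolding magnitude_boundary_def
    by (intro order.trans [OF keys_sum]) (auto simp: subset_eq)
qed

lemma subgroup_magnitude_cycles:
  "subgroup (magnitude_cycles V E k l) (magnitude_chain_group V E k l)"
proof -
  let ?G = "magnitude_chain_group V E k l"
  interpret group_hom ?G "free_Abelian_group UNIV" "magnitude_boundary V E k l"
    by (auto simp: group_hom_def group_hom_axioms_def hom_def magnitude_chain_group_def
        magnitude_boundary_add)
  have "magnitude_cycles V E k l = kernel ?G (free_Abelian_group UNIV) (magnitude_boundary V E k l)"
    by (simp add: magnitude_cycles_def kernel_def)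
  then show ?thesis
    using subgroup_kernel by simp
qed

lemma subgroup_magnitude_boundaries:
  "subgroup (magnitude_boundaries V E k l) (magnitude_chain_group V E k l)"
proof -
  interpret group_hom "magnitude_chain_group V E (k + 1) l" "magnitude_chain_group V E k l"
      "magnitude_boundary V E (k + 1) l"
    using keys_magnitude_boundary [of V E "k + 1" l]
    by (auto simp: group_hom_def group_hom_axioms_def hom_def magnitude_chain_group_def
        magnitude_boundary_add)
  show ?thesis
    unfolding magnitude_boundaries_def using img_is_subgroup .
qed

text \<open>The values of \<open>\<phi>\<close> on boundaries are multiples of \<open>N\<close>, so
  if \<open>j\<close> times \<open>c\<close> bounds, then \<open>N\<close> divides
  \<open>j * \<phi> c = j\<close>. Since \<open>N\<close> times \<open>c\<close> does bound, the
  class of \<open>c\<close> has order exactly \<open>N\<close>.\<close>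

lemma has_cyclic_subgroup_magnitude_homology:
  fixes \<phi> :: "('a list \<Rightarrow>\<^sub>0 int) \<Rightarrow> int"
  assumes N: "N > 0"
    and c: "c \<in> magnitude_cycles V E k l"
    and Nc: "frag_cmul (int N) c \<in> magnitude_boundaries V E k l"
    and diff: "\<And>x y. \<phi> (x - y) = \<phi> x - \<phi> y"
    and cmul: "\<And>j x. \<phi> (frag_cmul j x) = j * \<phi> x"
    and cocycle: "\<And>xs. xs \<in> k_paths V E (k + 1) l \<Longrightarrow>
      int N dvd \<phi> (magnitude_boundary V E (k + 1) l (frag_of xs))"
    and one: "\<phi> c = 1"
  shows "has_subgroup_iso (magnitude_homology V E k l) (integer_mod_group N)"
proof -
  let ?G = "magnitude_chain_group V E k l"
  interpret comm_group ?G
    by (simp add: magnitude_chain_group_def abelian_free_Abelian_group)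
  have \<phi>0: "\<phi> 0 = 0"
    using diff [of 0 0] by simp
  have bd: "int N dvd \<phi> x" if "x \<in> magnitude_boundaries V E k l" for x
  proof -
    from that obtain d where d: "Poly_Mapping.keys d \<subseteq> k_paths V E (k + 1) l"
      and x: "x = magnitude_boundary V E (k + 1) l d"
      by (auto simp: magnitude_boundaries_def magnitude_chain_group_def)
    show ?thesis
      unfolding x using d
      by (induction d rule: frag_induction)
        (use cocycle in \<open>auto simp: \<phi>0 magnitude_boundary_diff diff\<close>)
  qed
  have pow: "c [^]\<^bsub>?G\<^esub> j = frag_cmul j c" for j :: int
    using c by (simp add: magnitude_cycles_def magnitude_chain_group_def)
  have "frag_cmul j c \<in> magnitude_boundaries V E k l \<longleftrightarrow> int N dvd j" for j
  proof
    assume "frag_cmul j c \<in> magnitude_boundaries V E k l"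
    from bd [OF this] show "int N dvd j"
      by (simp add: cmul one)
  next
    assume "int N dvd j"
    then obtain i where i: "j = int N * i" by blast
    have carr: "c \<in> carrier ?G"
      using c by (simp add: magnitude_cycles_def)
    have "frag_cmul (int N) c [^]\<^bsub>?G\<^esub> i \<in> magnitude_boundaries V E k l"
      using Nc by (rule subgroup_int_pow_closed [OF subgroup_magnitude_boundaries, unfolded pow])
    then show "frag_cmul j c \<in> magnitude_boundaries V E k l"
      by (simp add: int_pow_pow [OF carr] i mult.commute flip: pow)
  qed
  then show ?thesis
    unfolding magnitude_homology_def
    by (intro has_subgroup_iso_Mod_cyclic [OF subgroup_magnitude_cycles
          subgroup_magnitude_boundaries c N]) (simp add: pow)
qed

section \<open>Geodesics in graded graphs\<close>

lemma graph_dist_le: "(x, y) \<in> E ^^ n \<Longrightarrow> graph_dist E x y \<le> enat n"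
  by (simp add: graph_dist_def INF_lower)

lemma graph_dist_walk:
  assumes "graph_dist E x y = enat n"
  shows "(x, y) \<in> E ^^ n"
proof -
  let ?S = "enat ` {n. (x, y) \<in> E ^^ n}"
  have "?S \<noteq> {}"
  proof
    assume "?S = {}"
    then have "Inf ?S = \<infinity>"
      by (simp only: Inf_enat_def simp_thms if_True)
    with assms show False
      by (simp add: graph_dist_def)
  qed
  then have "Inf ?S \<in> ?S"
    unfolding Inf_enat_def by (auto intro: LeastI)
  then show ?thesis
    using assms by (auto simp: graph_dist_def)
qed

lemma path_length_singleton [simp]: "path_length E [x] = 0"
  by (simp add: path_length_def)

lemma path_length_Cons [simp]:
  "path_length E (x # y # ys) = graph_dist E x y + path_length E (y # ys)"
  by (simp add: path_length_def sum.lessThan_Suc_shift del: sum.lessThan_Suc)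

text \<open>\<open>A\<close> plays the Hasse diagram of a poset with rank function \<open>L\<close>:
  its transitive closure is the strict order, and forgetting directions gives the graph.\<close>

locale graded_graph =
  fixes V :: "'a set" and A :: "'a rel" and L :: "'a \<Rightarrow> nat"
  assumes finite_V: "finite V"
    and arc_V: "A \<subseteq> V \<times> V"
    and arc_L: "(x, y) \<in> A \<Longrightarrow> L y = Suc (L x)"
begin

abbreviation E :: "'a rel"
  where "E \<equiv> A \<union> A\<inverse>"

abbreviation prec :: "'a \<Rightarrow> 'a \<Rightarrow> bool"  (infix \<open>\<prec>\<^sub>A\<close> 50)
  where "x \<prec>\<^sub>A y \<equiv> (x, y) \<in> A\<^sup>+"

lemma finite_simple_graph: "finite_simple_graph V E"
proof
  show "irrefl E"
    using arc_L by (fastforce simp: irrefl_def)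
qed (use finite_V arc_V in \<open>auto simp: sym_def\<close>)

lemma L_ascend: "(x, y) \<in> A ^^ n \<Longrightarrow> L y = L x + n"
  by (induction n arbitrary: y) (auto dest: arc_L)

text \<open>Each step changes the level by one up or down, so a walk reaches the maximal climb only
  if it never descends.\<close>

lemma L_walk: "(x, y) \<in> E ^^ n \<Longrightarrow> L y \<le> L x + n \<and> (L y = L x + n \<longrightarrow> (x, y) \<in> A ^^ n)"
proof (induction n arbitrary: y)
  case (Suc n)
  then obtain z where z: "(x, z) \<in> E ^^ n" "(z, y) \<in> E" by auto
  from z(2) show ?case
  proof
    assume "(z, y) \<in> A"
    with Suc.IH [OF z(1)] arc_L [of z y] show ?thesis by auto
  next
    assume "(z, y) \<in> A\<inverse>"
    with Suc.IH [OF z(1)] arc_L [of y z] show ?thesis by auto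
  qed
qed auto

lemma graph_dist_ascend: "(x, y) \<in> A ^^ n \<Longrightarrow> graph_dist E x y = enat n"
proof -
  assume xy: "(x, y) \<in> A ^^ n"
  then have "(x, y) \<in> E ^^ n"
    by (induction n arbitrary: y) auto
  then have "graph_dist E x y \<le> enat n"
    by (rule graph_dist_le)
  then obtain m where m: "graph_dist E x y = enat m" "m \<le> n"
    by (cases "graph_dist E x y") auto
  moreover have "n \<le> m"
    using L_walk [OF graph_dist_walk [OF m(1)]] L_ascend [OF xy] by simp
  ultimately show ?thesis by simp
qed

text \<open>By \<open>L_walk\<close>, the climb of each segment is at most its distance; equality
  for the sum forces equality in every segment.\<close>

lemma L_path_length:
  assumes "path_length E (x # xs) = enat n"
  shows "L (last (x # xs)) \<le> L x + n \<and>
    (L (last (x # xs)) = L x + n \<longrightarrow> successively (\<lambda>x y. (x, y) \<in> A\<^sup>*) (x # xs))"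
  using assms
proof (induction xs arbitrary: x n)
  case (Cons y ys)
  then obtain i j where ij: "graph_dist E x y = enat i" "path_length E (y # ys) = enat j" "n = i + j"
    by (cases "graph_dist E x y"; cases "path_length E (y # ys)") auto
  have xy: "L y \<le> L x + i \<and> (L y = L x + i \<longrightarrow> (x, y) \<in> A\<^sup>*)"
    using L_walk [OF graph_dist_walk [OF ij(1)]] by (auto dest: relpow_imp_rtrancl)
  have "L (last (x # y # ys)) \<le> L x + n"
    using Cons.IH [OF ij(2)] xy ij(3) by simp
  moreover have "successively (\<lambda>x y. (x, y) \<in> A\<^sup>*) (x # y # ys)" if "L (last (x # y # ys)) = L x + n"
  proof -
    have "L y = L x + i \<and> L (last (y # ys)) = L y + j"
      using Cons.IH [OF ij(2)] xy ij(3) that by simp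
    then show ?thesis
      using Cons.IH [OF ij(2)] xy by simp
  qed
  ultimately show ?case by blast
qed simp

lemma ascend_path_length:
  "successively (\<lambda>x y. (x, y) \<in> A\<^sup>*) (x # xs) \<Longrightarrow>
    L x \<le> L (last (x # xs)) \<and> path_length E (x # xs) = enat (L (last (x # xs)) - L x)"
proof (induction xs arbitrary: x)
  case (Cons y ys)
  then obtain n where n: "(x, y) \<in> A ^^ n"
    by (auto simp: rtrancl_is_UN_relpow)
  show ?case
    using Cons.IH [of y] Cons.prems graph_dist_ascend [OF n] L_ascend [OF n] by simp
qed (simp add: zero_enat_def)

lemma prec_neq: "x \<prec>\<^sub>A y \<Longrightarrow> x \<noteq> y"
  by (metis L_ascend add_cancel_right_right less_not_refl trancl_power)

text \<open>When the levels of the two ends differ by the prescribed length, a path has no slack and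
  must be a strict chain. This is what reduces magnitude chains to the order complex of an open
  interval.\<close>

lemma geodesic_k_paths_iff:
  assumes "length xs = Suc k" and "L (last xs) = L (hd xs) + l"
  shows "xs \<in> k_paths V E k l \<longleftrightarrow> set xs \<subseteq> V \<and> successively (\<prec>\<^sub>A) xs"
proof -
  from assms(1) obtain x ys where xs: "xs = x # ys" by (cases xs) auto
  have dist: "graph_dist E u v < \<infinity>" if uv: "u \<prec>\<^sub>A v" for u v
  proof -
    from uv obtain n where n: "(u, v) \<in> A ^^ n"
      by (auto simp: trancl_power)
    show ?thesis
      unfolding graph_dist_ascend [OF n] by simp
  qed
  show ?thesis
  proof
    assume *: "xs \<in> k_paths V E k l"
    then have "successively (\<lambda>x y. (x, y) \<in> A\<^sup>*) xs"
      using L_path_length [of x ys l] assms(2) by (auto simp: k_paths_def xs)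
    \<comment> \<open>Consecutive entries of a path differ, which excludes the reflexive case of
      \<open>A\<^sup>*\<close>.\<close>
    with * assms(1) show "set xs \<subseteq> V \<and> successively (\<prec>\<^sub>A) xs"
      by (auto simp: k_paths_def is_k_path_def successively_conv_nth rtrancl_eq_or_trancl)
  next
    assume *: "set xs \<subseteq> V \<and> successively (\<prec>\<^sub>A) xs"
    then have "successively (\<lambda>x y. (x, y) \<in> A\<^sup>*) xs"
      by (auto elim: successively_mono)
    then have "path_length E xs = enat l"
      using ascend_path_length [of x ys] assms(2) by (simp add: xs)
    then show "xs \<in> k_paths V E k l"
      using * assms(1) dist prec_neq
      by (auto simp: k_paths_def is_k_path_def successively_conv_nth)
  qed
qed

lemma prec_V: "x \<prec>\<^sub>A y \<Longrightarrow> x \<in> V \<and> y \<in> V"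
  using trancl_subset_Sigma [OF arc_V] by blast

end

section \<open>Torsion from a disk glued to a circle\<close>

lemma magnitude_boundary_3:
  assumes "S = k_paths V E 2 l"
  shows "magnitude_boundary V E 3 l (frag_of [a, x, y, b]) =
    (if [a, x, b] \<in> S then frag_of [a, x, b] else 0) - (if [a, y, b] \<in> S then frag_of [a, y, b] else 0)"
proof -
  have "{1..<3} = {1, 2::nat}" by auto
  then show ?thesis
    using assms by (simp add: magnitude_boundary_def magnitude_face_def delete_nth_def)
qed

text \<open>With \<open>a\<close> and \<open>b\<close> dropped and all faces present, this is minus
  the simplicial boundary of the triangle \<open>x, y, z\<close>.\<close>

lemma magnitude_boundary_4:
  assumes "S = k_paths V E 3 l"
  shows "magnitude_boundary V E 4 l (frag_of [a, x, y, z, b]) =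
    (if [a, x, z, b] \<in> S then frag_of [a, x, z, b] else 0)
    - (if [a, y, z, b] \<in> S then frag_of [a, y, z, b] else 0)
    - (if [a, x, y, b] \<in> S then frag_of [a, x, y, b] else 0)"
proof -
  have "{1..<4} = {1, 2, 3::nat}" by auto
  then show ?thesis
    using assms by (simp add: magnitude_boundary_def magnitude_face_def delete_nth_def)
qed

text \<open>Here \<open>u, e\<close> are the vertices and edges of the circle (of which there are two each),
  \<open>t\<close> is the centre of the disk, \<open>s k\<close> its \<open>2 * N\<close> spokes and \<open>f k\<close> the sector bounded by
  \<open>s k\<close>, \<open>e k\<close> and \<open>s (k + 1)\<close>.\<close>

lemma (in graded_graph) torsion_of_disk:
  fixes \<psi> :: "'a \<Rightarrow> 'a \<Rightarrow> int" and u e s f :: "nat \<Rightarrow> 'a"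
  assumes N: "N > 0" and ab: "L b = L a + l"
    and periodic: "\<And>k. u (k + 2) = u k" "\<And>k. e (k + 2) = e k" "\<And>k. s (k + 2 * N) = s k"
    and bot: "a \<prec>\<^sub>A t" "\<And>k. a \<prec>\<^sub>A u k"
    and low: "\<And>k. t \<prec>\<^sub>A s k" "\<And>k. u k \<prec>\<^sub>A s k" "\<And>k. u k \<prec>\<^sub>A e k" "\<And>k. u (Suc k) \<prec>\<^sub>A e k"
    and high: "\<And>k. s k \<prec>\<^sub>A f k" "\<And>k. s (Suc k) \<prec>\<^sub>A f k" "\<And>k. e k \<prec>\<^sub>A f k"
    and top: "\<And>k. f k \<prec>\<^sub>A b"
    and cocycle: "\<And>x y z. \<lbrakk>a \<prec>\<^sub>A x; x \<prec>\<^sub>A y; y \<prec>\<^sub>A z; z \<prec>\<^sub>A b\<rbrakk> \<Longrightarrow> int N dvd \<psi> x z - \<psi> y z - \<psi> x y"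
    and one: "\<psi> (u 0) (e 0) - \<psi> (u 1) (e 0) + \<psi> (u 1) (e 1) - \<psi> (u 0) (e 1) = 1"
  shows "has_subgroup_iso (magnitude_homology V E 3 l) (integer_mod_group N)"
proof -
  define P where "P x y = frag_of [a, x, y, b]" for x y
  define D where "D x y z = frag_of [a, x, y, z, b]" for x y z
  have path3: "[a, x, y, b] \<in> k_paths V E 3 l \<longleftrightarrow> a \<prec>\<^sub>A x \<and> x \<prec>\<^sub>A y \<and> y \<prec>\<^sub>A b" for x y
    using ab by (subst geodesic_k_paths_iff) (auto dest: prec_V)
  have path4: "[a, x, y, z, b] \<in> k_paths V E 4 l \<longleftrightarrow> a \<prec>\<^sub>A x \<and> x \<prec>\<^sub>A y \<and> y \<prec>\<^sub>A z \<and> z \<prec>\<^sub>A b" for x y z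
    using ab by (subst geodesic_k_paths_iff) (auto dest: prec_V)
  have bd_D: "magnitude_boundary V E 4 l (D x y z) = P x z - P y z - P x y"
    if "a \<prec>\<^sub>A x" "x \<prec>\<^sub>A y" "y \<prec>\<^sub>A z" "z \<prec>\<^sub>A b" for x y z
    unfolding D_def P_def using that
    by (subst magnitude_boundary_4 [OF refl]) (auto simp: path3 intro: trancl_trans)
  \<comment> \<open>In the barycentric subdivision, \<open>r k\<close> is the rim edge
    \<open>e k\<close> from \<open>u k\<close> to \<open>u (Suc k)\<close>, \<open>q k\<close> the
    spoke from \<open>t\<close> to \<open>u k\<close>, \<open>d k\<close> the sector
    \<open>f k\<close> cut into six triangles with alternating signs, and \<open>c\<close> the
    circle traversed once.\<close>
  define r where "r k = P (u k) (e k) - P (u (Suc k)) (e k)" for k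
  define q where "q k = P t (s k) - P (u k) (s k)" for k
  define d where "d k = D (u (Suc k)) (s (Suc k)) (f k) - D t (s (Suc k)) (f k)
    + D (u k) (e k) (f k) - D (u (Suc k)) (e k) (f k) + D t (s k) (f k) - D (u k) (s k) (f k)" for k
  define c where "c = r 0 + r 1"
  have above: "s k \<prec>\<^sub>A b" "e k \<prec>\<^sub>A b" for k
    using high top by (blast intro: trancl_trans)+
  note chain = bot low high top
  \<comment> \<open>The six edges at \<open>f k\<close> cancel in pairs; what remains is the outline
    of the sector, two spokes and one rim edge.\<close>
  have bd_d: "magnitude_boundary V E 4 l (d k) = (q (Suc k) - q k) - r k" for k
    unfolding d_def magnitude_boundary_add magnitude_boundary_diff
    using chain by (simp add: bd_D q_def r_def)
  have q_periodic: "q (2 * N) = q 0"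
  proof -
    have "u (2 * j) = u 0" for j
      by (induction j) (use periodic(1) in \<open>simp_all\<close>)
    then show ?thesis
      using periodic(3) [of 0] by (simp add: q_def)
  qed
  have r_periodic: "r (k + 2) = r k" for k
    using periodic(1,2) [of k] periodic(1) [of "Suc k"] by (simp add: r_def)
  have r_step: "r (2 * j) + r (Suc (2 * j)) = c" for j
    by (induction j) (use r_periodic in \<open>simp_all add: c_def\<close>)
  have r_sum: "(\<Sum>k<2 * j. r k) = frag_cmul (int j) c" for j
  proof (induction j)
    case (Suc j)
    have "(\<Sum>k<2 * Suc j. r k) = (\<Sum>k<2 * j. r k) + (r (2 * j) + r (Suc (2 * j)))"
      by (simp add: add.assoc)
    also have "\<dots> = frag_cmul (int (Suc j)) c"
      unfolding r_step Suc.IH by (simp add: frag_cmul_distrib)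
    finally show ?case .
  qed simp
  \<comment> \<open>Around the disk the spokes telescope to zero, while the \<open>2 * N\<close> rim
    edges run \<open>N\<close> times round the circle, each with a minus sign.\<close>
  have bd: "magnitude_boundary V E 4 l (- (\<Sum>k<2 * N. d k)) = frag_cmul (int N) c"
    unfolding magnitude_boundary_uminus magnitude_boundary_sum bd_d
      sum_subtractf [of "\<lambda>k. q (Suc k) - q k" r] sum_lessThan_telescope r_sum q_periodic by simp
  have D_carrier: "D x y z \<in> carrier (free_Abelian_group (k_paths V E 4 l))"
    if "a \<prec>\<^sub>A x" "x \<prec>\<^sub>A y" "y \<prec>\<^sub>A z" "z \<prec>\<^sub>A b" for x y z
    using that by (simp add: D_def path4)
  have P_carrier: "P x y \<in> carrier (free_Abelian_group (k_paths V E 3 l))"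
    if "a \<prec>\<^sub>A x" "x \<prec>\<^sub>A y" "y \<prec>\<^sub>A b" for x y
    using that by (simp add: P_def path3)
  have closed: "x + y \<in> carrier (free_Abelian_group S)" "x - y \<in> carrier (free_Abelian_group S)"
    if "x \<in> carrier (free_Abelian_group S)" "y \<in> carrier (free_Abelian_group S)"
    for x y and S :: "'a list set"
    using that Poly_Mapping.keys_add [of x y] keys_diff [of x y] by auto
  have d_carrier: "d k \<in> carrier (free_Abelian_group (k_paths V E 4 l))" for k
    unfolding d_def by (intro closed D_carrier chain)
  have "frag_cmul (int N) c \<in> magnitude_boundaries V E 3 l"
  proof -
    have "- (\<Sum>k<2 * N. d k) \<in> carrier (free_Abelian_group (k_paths V E 4 l))"
      using sum_closed_free_Abelian_group [OF d_carrier] by simp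
    then show ?thesis
      unfolding magnitude_boundaries_def magnitude_chain_group_def bd [symmetric] by simp
  qed
  moreover have "c \<in> magnitude_cycles V E 3 l"
  proof -
    have "c \<in> carrier (magnitude_chain_group V E 3 l)"
      unfolding c_def r_def magnitude_chain_group_def by (intro closed P_carrier chain above)
    \<comment> \<open>The two terms at each \<open>e k\<close> cancel, and those at the vertices
      cancel because \<open>u 2 = u 0\<close> closes the circle.\<close>
    moreover have "magnitude_boundary V E 3 l c = 0"
      unfolding c_def r_def P_def magnitude_boundary_add magnitude_boundary_diff
        magnitude_boundary_3 [OF refl] using periodic(1) [of 0] by (simp add: numeral_2_eq_2)
    ultimately show ?thesis
      by (simp add: magnitude_cycles_def)
  qed
  \<comment> \<open>The chain group contains paths between all pairs of ends; the cochain is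
    \<open>\<psi>\<close> on those from \<open>a\<close> to \<open>b\<close> and zero on the
    others.\<close>
  moreover define g where "g xs = (if hd xs = a \<and> last xs = b then \<psi> (xs ! 1) (xs ! 2) else 0)" for xs
  \<comment> \<open>\<open>frag_extend\<close> takes values in a free abelian group, so the integers
    are modelled as the one generated by \<open>()\<close> and read off as its coefficient.\<close>
  define \<phi> where "\<phi> x = Poly_Mapping.lookup (frag_extend (\<lambda>xs. frag_cmul (g xs) (frag_of ())) x) ()" for x
  have \<phi>_diff: "\<phi> (x - y) = \<phi> x - \<phi> y" for x y
    by (simp add: \<phi>_def frag_extend_diff lookup_minus)
  moreover have "\<phi> (frag_cmul j x) = j * \<phi> x" for j x
    by (simp add: \<phi>_def frag_extend_cmul)
  moreover have \<phi>_of: "\<phi> (frag_of xs) = g xs" for xs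
    by (simp add: \<phi>_def)
  moreover have "int N dvd \<phi> (magnitude_boundary V E (3 + 1) l (frag_of xs))"
    if xs: "xs \<in> k_paths V E (3 + 1) l" for xs
  proof -
    have "length xs = 5"
      using xs by (simp add: k_paths_def is_k_path_def)
    then obtain v x y z w where xs_eq: "xs = [v, x, y, z, w]"
      by (auto simp: length_Suc_conv eval_nat_numeral)
    have \<phi>_0: "\<phi> 0 = 0"
      by (simp add: \<phi>_def)
    show ?thesis
    proof (cases "v = a \<and> w = b")
      case True
      then have chain: "a \<prec>\<^sub>A x" "x \<prec>\<^sub>A y" "y \<prec>\<^sub>A z" "z \<prec>\<^sub>A b"
        using xs path4 by (simp_all add: xs_eq)
      have "magnitude_boundary V E (3 + 1) l (frag_of xs) = P x z - P y z - P x y"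
        using bd_D [OF chain] True by (simp add: xs_eq D_def)
      then show ?thesis
        using cocycle [OF chain] by (simp add: P_def \<phi>_diff \<phi>_of g_def)
    next
      case False
      \<comment> \<open>Faces delete inner entries only, so every face keeps the wrong ends and
        \<open>g\<close> vanishes on it.\<close>
      then have "\<phi> (magnitude_boundary V E 4 l (frag_of xs)) = 0"
        unfolding xs_eq magnitude_boundary_4 [OF refl] \<phi>_diff by (auto simp: \<phi>_of \<phi>_0 g_def)
      then show ?thesis by simp
    qed
  qed
  moreover have "\<phi> c = 1"
  proof -
    have "c = P (u 0) (e 0) - P (u 1) (e 0) - (P (u 0) (e 1) - P (u 1) (e 1))"
      using periodic(1) [of 0] by (simp add: c_def r_def numeral_2_eq_2)
    then show ?thesis
      using one by (simp add: \<phi>_diff P_def \<phi>_of g_def)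
  qed
  ultimately show ?thesis
    by (intro has_cyclic_subgroup_magnitude_homology [where \<phi> = \<phi>, OF N]) auto
qed

section \<open>The graph\<close>

text \<open>\<open>Low j i\<close> is the \<open>i\<close>-th vertex on the \<open>j\<close>-th of three subdivided edges leaving
  \<open>Bot\<close>, which end in the two vertices of the circle (\<open>j = 0, 1\<close>) and the centre of the disk
  (\<open>j = 2\<close>).\<close>

datatype vert = Bot | Low nat nat | Spoke nat | Rim nat | Face nat | Top

instance vert :: countable
  by countable_datatype

text \<open>The \<open>M\<close> vertices on each subdivided edge lift \<open>Top\<close> to level
  \<open>M + 3\<close>, the length of the chains considered.\<close>

fun rank :: "nat \<Rightarrow> vert \<Rightarrow> nat" where
  "rank M Bot = 0"
| "rank M (Low j i) = Suc i"
| "rank M (Spoke k) = Suc M"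
| "rank M (Rim i) = Suc M"
| "rank M (Face k) = Suc (Suc M)"
| "rank M Top = Suc (Suc (Suc M))"

definition verts :: "nat \<Rightarrow> nat \<Rightarrow> vert set"
  where "verts M N = {Bot, Top} \<union> (\<lambda>(j, i). Low j i) ` ({..<3} \<times> {..<M}) \<union> Spoke ` {..<2 * N}
    \<union> Rim ` {..<2} \<union> Face ` {..<2 * N}"

lemma verts_iff [simp]:
  "Bot \<in> verts M N" "Top \<in> verts M N"
  "Low j i \<in> verts M N \<longleftrightarrow> j < 3 \<and> i < M"
  "Spoke k \<in> verts M N \<longleftrightarrow> k < 2 * N"
  "Rim k \<in> verts M N \<longleftrightarrow> k < 2"
  "Face k \<in> verts M N \<longleftrightarrow> k < 2 * N"
  by (auto simp: verts_def)

text \<open>The gluing of degree \<open>N\<close> lies in the indices: sectors and spokes are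
  counted modulo \<open>2 * N\<close>, but meet the circle according to parity. The relation is
  given transitively closed, so that chains can be analysed by cases.\<close>

fun below :: "nat \<Rightarrow> vert \<Rightarrow> vert \<Rightarrow> bool" where
  "below N Bot y = (y \<noteq> Bot)"
| "below N (Low j i) (Low j' i') = (j = j' \<and> i < i')"
| "below N (Low j i) (Spoke k) = (j = 2 \<or> j = k mod 2)"
| "below N (Low j i) (Rim k) = (j \<noteq> 2)"
| "below N (Low j i) (Face k) = True"
| "below N (Spoke k) (Face k') = (k = k' \<or> k = Suc k' mod (2 * N))"
| "below N (Rim i) (Face k) = (i = k mod 2)"
| "below N x Top = (x \<noteq> Top)"
| "below N x y = False"

lemma below_trans: "below N x y \<Longrightarrow> below N y z \<Longrightarrow> below N x z"
  by (cases x; cases y; cases z; simp)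

text \<open>Modulo \<open>N\<close>, the sum along a closed walk in the order complex counts how often the walk winds
  around the circle: crossing the rim 1 at vertex 0 counts \<open>- 1\<close>, and the disk is cut open at
  spoke 0.\<close>

fun winding :: "vert \<Rightarrow> vert \<Rightarrow> int" where
  "winding (Low j i) (Spoke k) = (if j = 2 then 0 else - int (k div 2))"
| "winding (Low j i) (Rim k) = (if j = 0 \<and> k = 1 then - 1 else 0)"
| "winding (Low j i) (Face k) =
    (if j = 2 then 0 else if j = 0 then - int (Suc k div 2) else - int (k div 2))"
| "winding (Rim i) (Face k) = - int (k div 2)"
| "winding x y = 0"

text \<open>The expression is exactly 0 on every triangle except those across the cut, where spoke 0
  closes the last sector; there it is \<open>- int N\<close>.\<close>

lemma winding_cocycle:
  assumes "{x, y, z} \<subseteq> verts M N" "below N Bot x" "below N x y" "below N y z" "below N z Top"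
  shows "int N dvd winding x z - winding y z - winding x y"
proof -
  have even_half: "Suc m div 2 = m div 2" if "m mod 2 = 0" for m
    using that by presburger
  have odd_half: "Suc m div 2 = Suc (m div 2)" if "m mod 2 \<noteq> 0" for m
    using that by presburger
  \<comment> \<open>A chain of three either begins with two vertices of one subdivided edge, between
    which \<open>winding\<close> does not distinguish, or climbs through a spoke or a rim edge to a
    face.\<close>
  consider (low) j i i' where "x = Low j i" "y = Low j i'"
    | (spoke) j i k k' where "x = Low j i" "y = Spoke k" "z = Face k'"
    | (rim) j i i' k where "x = Low j i" "y = Rim i'" "z = Face k"
    using assms(2-) by (cases x; cases y; cases z; auto)
  then show ?thesis
  proof cases
    case low
    then show ?thesis by (cases z) auto
  next
    case spoke
    then have bounds: "j < 3" "k' < 2 * N"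
      and jk: "j = 2 \<or> j = k mod 2" and k: "k = k' \<or> k = Suc k' mod (2 * N)"
      using assms by auto
    consider "j = 2" | "j = k mod 2" "k = k'" | "j = k mod 2" "k = Suc k'"
      | "j = 0" "k = 0" "Suc k' = 2 * N"
      using jk k bounds(2) by (cases "Suc k' = 2 * N") auto
    then show ?thesis
    proof cases
      case 2
      then show ?thesis using spoke even_half [of k] by auto
    next
      case 3
      then show ?thesis using spoke even_half [of k'] by (auto simp: mod_Suc split: if_splits)
    next
      \<comment> \<open>The triangle across the cut: the half index jumps from \<open>N\<close> back
        to 0.\<close>
      case 4
      then show ?thesis using spoke by auto
    qed (use spoke in simp)
  next
    case rim
    then have "j < 2" "i' = k mod 2"
      using assms by auto
    then show ?thesis
      using rim even_half [of k] odd_half [of k] by (auto simp: less_2_cases_iff)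
  qed
qed

section \<open>Transport to a graph on natural numbers\<close>

definition graph_verts :: "nat \<Rightarrow> nat \<Rightarrow> nat set"
  where "graph_verts M N = to_nat ` verts M N"

definition graph_arcs :: "nat \<Rightarrow> nat \<Rightarrow> nat rel"
  where "graph_arcs M N = {(to_nat x, to_nat y) | x y.
    x \<in> verts M N \<and> y \<in> verts M N \<and> below N x y \<and> rank M y = Suc (rank M x)}"

lemma graded_graph: "graded_graph (graph_verts M N) (graph_arcs M N) (\<lambda>v. rank M (from_nat v))"
proof
  show "finite (graph_verts M N)"
    by (simp add: graph_verts_def verts_def)
qed (auto simp: graph_verts_def graph_arcs_def)

lemma arcI:
  "\<lbrakk>x \<in> verts M N; y \<in> verts M N; below N x y; rank M y = Suc (rank M x)\<rbrakk> \<Longrightarrow>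
    (to_nat x, to_nat y) \<in> (graph_arcs M N)\<^sup>+"
  by (auto simp: graph_arcs_def)

text \<open>This carries the cocycle condition, checked for \<open>below\<close>, over to chains of
  the graph.\<close>

lemma below_of_arcs:
  "(v, w) \<in> (graph_arcs M N)\<^sup>+ \<Longrightarrow> from_nat v \<in> verts M N \<and> from_nat w \<in> verts M N \<and>
    below N (from_nat v) (from_nat w)"
proof (induction rule: trancl_induct)
  case (step w w')
  then have "from_nat w' \<in> verts M N" "below N (from_nat w) (from_nat w')"
    by (auto simp: graph_arcs_def)
  with step.IH show ?case
    using below_trans by blast
qed (auto simp: graph_arcs_def)

lemma Bot_Low: "j < 3 \<Longrightarrow> i < M \<Longrightarrow> (to_nat Bot, to_nat (Low j i)) \<in> (graph_arcs M N)\<^sup>+"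
proof (induction i)
  case 0
  then show ?case
    by (intro arcI) simp_all
next
  case (Suc i)
  then have "(to_nat (Low j i), to_nat (Low j (Suc i))) \<in> (graph_arcs M N)\<^sup>+"
    by (intro arcI) simp_all
  with Suc show ?case
    by (meson Suc_lessD trancl_trans)
qed

lemma torsion_graph:
  assumes M: "M > 0" and N: "N > 0"
  shows "\<exists>(V :: nat set) E. finite_simple_graph V E \<and>
    has_subgroup_iso (magnitude_homology V E 3 (M + 3)) (integer_mod_group N)"
proof -
  interpret graded_graph "graph_verts M N" "graph_arcs M N" "\<lambda>v. rank M (from_nat v)"
    by (rule graded_graph)
  \<comment> \<open>The far ends \<open>Low j (M - 1)\<close> of the subdivided edges serve as
    circle vertices and centre; reducing indices makes the sequences periodic on all of
    \<open>nat\<close>.\<close>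
  define u where "u k = to_nat (Low (k mod 2) (M - 1))" for k
  define e where "e k = to_nat (Rim (k mod 2))" for k
  define s where "s k = to_nat (Spoke (k mod (2 * N)))" for k
  define f where "f k = to_nat (Face (k mod (2 * N)))" for k
  define t where "t = to_nat (Low 2 (M - 1))"
  note defs = u_def e_def s_def f_def t_def
  have mod2: "k mod (2 * N) mod 2 = k mod 2" for k
    by (simp add: mod_mod_cancel)
  have mod3: "k mod 2 < 3" for k :: nat
    by (rule less_trans [of _ 2]) simp_all
  have "has_subgroup_iso (magnitude_homology (graph_verts M N) E 3 (M + 3)) (integer_mod_group N)"
  proof (rule torsion_of_disk [of N "to_nat Top" "to_nat Bot" "M + 3" u e s t f
        "\<lambda>v w. winding (from_nat v) (from_nat w)"])
    fix x y z
    assume "(to_nat Bot, x) \<in> (graph_arcs M N)\<^sup>+" "(x, y) \<in> (graph_arcs M N)\<^sup>+"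
      "(y, z) \<in> (graph_arcs M N)\<^sup>+" "(z, to_nat Top) \<in> (graph_arcs M N)\<^sup>+"
    from this [THEN below_of_arcs]
    show "int N dvd winding (from_nat x) (from_nat z) - winding (from_nat y) (from_nat z)
        - winding (from_nat x) (from_nat y)"
      by (intro winding_cocycle [of _ _ _ M]) auto
  next
    show "(to_nat Bot, t) \<in> (graph_arcs M N)\<^sup>+" "(to_nat Bot, u k) \<in> (graph_arcs M N)\<^sup>+" for k
      unfolding defs using M mod3 by (intro Bot_Low; simp)+
  next
    show "(t, s k) \<in> (graph_arcs M N)\<^sup>+" "(u k, s k) \<in> (graph_arcs M N)\<^sup>+"
      "(u k, e k) \<in> (graph_arcs M N)\<^sup>+" "(u (Suc k), e k) \<in> (graph_arcs M N)\<^sup>+"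
      "(s k, f k) \<in> (graph_arcs M N)\<^sup>+" "(s (Suc k), f k) \<in> (graph_arcs M N)\<^sup>+"
      "(e k, f k) \<in> (graph_arcs M N)\<^sup>+" "(f k, to_nat Top) \<in> (graph_arcs M N)\<^sup>+" for k
      unfolding defs using M N mod3 by (intro arcI; simp add: mod2 mod_Suc_eq)+
  \<comment> \<open>What is left includes the normalisation, where only
    \<open>winding (Low 0 (M - 1)) (Rim 1) = - 1\<close> contributes.\<close>
  qed (use N in \<open>simp_all add: defs\<close>)
  then show ?thesis
    using finite_simple_graph by blast
qed

theorem theorem3p7:
  shows "(\<forall>p n r :: nat. prime p \<longrightarrow> n \<ge> 1 \<longrightarrow> r \<ge> 1 \<longrightarrow>
            (\<exists>(V :: nat set) E. finite_simple_graph V E \<and>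
               has_subgroup_iso (magnitude_homology V E 3 (2 * n + 3)) (integer_mod_group (p ^ r))))
       \<and> (\<forall>p r :: nat. prime p \<longrightarrow> r \<ge> 1 \<longrightarrow>
            (\<exists>(V :: nat set) E. finite_simple_graph V E \<and>
               (\<exists>k l. has_subgroup_iso (magnitude_homology V E k l) (integer_mod_group (p ^ r)))))"
proof -
  \<comment> \<open>Here \<open>M = 2 * n\<close> and \<open>N = p ^ r\<close>. The second conjunct
    follows with \<open>k = 3\<close> and \<open>l = 2 * n + 3\<close> for any positive
    \<open>n\<close>.\<close>
  have "\<exists>(V :: nat set) E. finite_simple_graph V E \<and>
      has_subgroup_iso (magnitude_homology V E 3 (2 * n + 3)) (integer_mod_group (p ^ r))"
    if "prime p" "n \<ge> 1" for p n r :: nat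
    using that by (intro torsion_graph) (auto simp: prime_gt_0_nat)
  then show ?thesis
    by blast
qed

end
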